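(* Let $\varrho$ be a left equalizer simple congruence on a semigroup $S$ and let $\mathbb{F}$ be a field. The right colon $(\mathbb{F}[\varrho]:_r\mathbb{F}[S])$ equals the augmentation ideal $\mathbb{F}[\omega_S]$ of $\mathbb{F}[S]$ if and only if the factor semigroup $S/\varrho$ is an ideal extension of a left zero semigroup by a null semigroup, that is, $S/\varrho$ has an ideal $L$ which is a left zero semigroup and the Rees factor semigroup $(S/\varrho)/L$ is a null semigroup.
   Context: $\mathbb{F}[S]$ denotes the semigroup algebra of $S$ over $\mathbb{F}$, having $S$ as an $\mathbb{F}$-basis with multiplication extending that of $S$; its elements are the finite sums $\sum_{s\in S}a(s)s$ with $a(s)\in\mathbb{F}$. For a congruence $\varrho$ on $S$, $\mathbb{F}[\varrho]$ denotes the ideal of $\mathbb{F}[S]$ that is the kernel of the extension $\mathbb{F}[S]\to\mathbb{F}[S/\varrho]$ of the canonical homomorphism $S\to S/\varrho$; equivalently, $\sum_{s\in S}a(s)s\in\mathbb{F}[\varrho]$ if and only if $\sum_{s\in A}a(s)=0$ for every $\varrho$-class $A$ of $S$. $\omega_S$ denotes the universal relation on $S$; thus $\mathbb{F}[\omega_S]$, the augmentation ideal, is the set of all $\sum_{s\in S}a(s)s$ with $\sum_{s\in S}a(s)=0$. For an ideal $J$ of $\mathbb{F}[S]$, $(J:_r\mathbb{F}[S])=\{a\in\mathbb{F}[S]: \mathbb{F}[S]a\subseteq J\}$ is the right colon of $J$. A congruence $\varrho$ on $S$ is left equalizer simple if for all $a,b\in S$, $(x_0a,x_0b)\in\varrho$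 for some $x_0\in S$ implies $(xa,xb)\in\varrho$ for all $x\in S$. A left zero semigroup is a semigroup satisfying the identity $ab=a$. A null semigroup is a semigroup $N$ with a zero element $0$ such that $N^2=\{0\}$. Ideals of semigroups are non-empty and two-sided; the Rees factor semigroup $Q/L$ of a semigroup $Q$ by an ideal $L$ is obtained by collapsing $L$ to a single (zero) element. *)

theory Defs
  imports "HOL-Algebra.Congruence" "HOL-Library.Poly_Mapping"
begin

section \<open>Semigroups and congruences\<close>

record 'a semigrp = "'a partial_object" +
  mult :: "['a, 'a] \<Rightarrow> 'a" (infixl \<open>\<otimes>\<index>\<close> 70)

text \<open>Semigroups are non-empty: over an empty carrier \<open>F[S] = 0\<close>, so any two ideals of
  \<open>F[S]\<close> would coincide, while there would be no (non-empty) ideal of \<open>S\<close>.\<close>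

locale semigrp =
  fixes S (structure)
  assumes nonempty: "carrier S \<noteq> {}"
    and m_closed: "\<lbrakk>x \<in> carrier S; y \<in> carrier S\<rbrakk> \<Longrightarrow> x \<otimes> y \<in> carrier S"
    and m_assoc: "\<lbrakk>x \<in> carrier S; y \<in> carrier S; z \<in> carrier S\<rbrakk>
      \<Longrightarrow> (x \<otimes> y) \<otimes> z = x \<otimes> (y \<otimes> z)"

definition semigrp_congruence :: "('a, 'm) semigrp_scheme \<Rightarrow> ('a \<times> 'a) set \<Rightarrow> bool"
  where "semigrp_congruence S \<rho> \<longleftrightarrow> equiv (carrier S) \<rho> \<and>
    (\<forall>a b x. (a, b) \<in> \<rho> \<longrightarrow> x \<in> carrier S \<longrightarrow>
      (x \<otimes>\<^bsub>S\<^esub> a, x \<otimes>\<^bsub>S\<^esub> b) \<in> \<rho> \<and> (a \<otimes>\<^bsub>S\<^esub> x, b \<otimes>\<^bsub>S\<^esub> x) \<in> \<rho>)"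

definition left_equalizer_simple :: "('a, 'm) semigrp_scheme \<Rightarrow> ('a \<times> 'a) set \<Rightarrow> bool"
  where "left_equalizer_simple S \<rho> \<longleftrightarrow> semigrp_congruence S \<rho> \<and>
    (\<forall>a \<in> carrier S. \<forall>b \<in> carrier S.
      (\<exists>x\<^sub>0 \<in> carrier S. (x\<^sub>0 \<otimes>\<^bsub>S\<^esub> a, x\<^sub>0 \<otimes>\<^bsub>S\<^esub> b) \<in> \<rho>) \<longrightarrow>
      (\<forall>x \<in> carrier S. (x \<otimes>\<^bsub>S\<^esub> a, x \<otimes>\<^bsub>S\<^esub> b) \<in> \<rho>))"

definition universal_rel :: "('a, 'm) semigrp_scheme \<Rightarrow> ('a \<times> 'a) set"
  where "universal_rel S = carrier S \<times> carrier S"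

text \<open>The product of two classes is the class containing their elementwise products;
  see \<open>factor_semigrp_mult\<close> below.\<close>

definition factor_semigrp :: "('a, 'm) semigrp_scheme \<Rightarrow> ('a \<times> 'a) set \<Rightarrow> 'a set semigrp"
  where "factor_semigrp S \<rho> =
    \<lparr>carrier = carrier S // \<rho>,
     mult = (\<lambda>A B. \<rho> `` {a \<otimes>\<^bsub>S\<^esub> b | a b. a \<in> A \<and> b \<in> B})\<rparr>"

definition semigrp_ideal :: "('a, 'm) semigrp_scheme \<Rightarrow> 'a set \<Rightarrow> bool"
  where "semigrp_ideal S L \<longleftrightarrow> L \<noteq> {} \<and> L \<subseteq> carrier S \<and>
    (\<forall>x \<in> carrier S. \<forall>l \<in> L. x \<otimes>\<^bsub>S\<^esub> l \<in> L \<and> l \<otimes>\<^bsub>S\<^esub> x \<in> L)"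

definition rees_congruence :: "('a, 'm) semigrp_scheme \<Rightarrow> 'a set \<Rightarrow> ('a \<times> 'a) set"
  where "rees_congruence S L = L \<times> L \<union> Id_on (carrier S)"

definition rees_factor :: "('a, 'm) semigrp_scheme \<Rightarrow> 'a set \<Rightarrow> 'a set semigrp"
  where "rees_factor S L = factor_semigrp S (rees_congruence S L)"

definition left_zero_semigrp :: "('a, 'm) semigrp_scheme \<Rightarrow> bool"
  where "left_zero_semigrp S \<longleftrightarrow> semigrp S \<and>
    (\<forall>a \<in> carrier S. \<forall>b \<in> carrier S. a \<otimes>\<^bsub>S\<^esub> b = a)"

definition null_semigrp :: "('a, 'm) semigrp_scheme \<Rightarrow> bool"
  where "null_semigrp N \<longleftrightarrow> semigrp N \<and>
    (\<exists>z \<in> carrier N.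
      (\<forall>a \<in> carrier N. z \<otimes>\<^bsub>N\<^esub> a = z \<and> a \<otimes>\<^bsub>N\<^esub> z = z) \<and>
      {a \<otimes>\<^bsub>N\<^esub> b | a b. a \<in> carrier N \<and> b \<in> carrier N} = {z})"


section \<open>Semigroup algebras\<close>

text \<open>
  An element of \<open>F[S]\<close> is a finitely supported map from the elements of \<open>S\<close> to the
  field. The multiplication of \<^typ>\<open>'a \<Rightarrow>\<^sub>0 'f\<close> provided by the library is the
  convolution over an additively written monoid, so it does not apply to a
  semigroup, which need not have a unit; \<open>conv S\<close> is the bilinear extension of the
  multiplication of \<open>S\<close>.
\<close>

definition semigrp_algebra :: "('a, 'm) semigrp_scheme \<Rightarrow> ('a \<Rightarrow>\<^sub>0 'f::field) set"
  where "semigrp_algebra S = {a. Poly_Mapping.keys a \<subseteq> carrier S}"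

definition conv ::
    "('a, 'm) semigrp_scheme \<Rightarrow> ('a \<Rightarrow>\<^sub>0 'f::field) \<Rightarrow> ('a \<Rightarrow>\<^sub>0 'f) \<Rightarrow> ('a \<Rightarrow>\<^sub>0 'f)"
  where "conv S a b =
    (\<Sum>s \<in> Poly_Mapping.keys a. \<Sum>t \<in> Poly_Mapping.keys b.
      Poly_Mapping.single (s \<otimes>\<^bsub>S\<^esub> t) (Poly_Mapping.lookup a s * Poly_Mapping.lookup b t))"

definition linear_extension :: "('a \<Rightarrow> 'b) \<Rightarrow> ('a \<Rightarrow>\<^sub>0 'f::field) \<Rightarrow> ('b \<Rightarrow>\<^sub>0 'f)"
  where "linear_extension h a =
    (\<Sum>s \<in> Poly_Mapping.keys a. Poly_Mapping.single (h s) (Poly_Mapping.lookup a s))"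

text \<open>\<open>F[\<rho>]\<close>, the kernel of the extension of \<open>S \<rightarrow> S/\<rho>\<close> to \<open>F[S] \<rightarrow> F[S/\<rho>]\<close>.\<close>

definition congruence_ideal ::
    "('a, 'm) semigrp_scheme \<Rightarrow> ('a \<times> 'a) set \<Rightarrow> ('a \<Rightarrow>\<^sub>0 'f::field) set"
  where "congruence_ideal S \<rho> =
    {a \<in> semigrp_algebra S. linear_extension (\<lambda>s. \<rho> `` {s}) a = 0}"

definition augmentation_ideal :: "('a, 'm) semigrp_scheme \<Rightarrow> ('a \<Rightarrow>\<^sub>0 'f::field) set"
  where "augmentation_ideal S = congruence_ideal S (universal_rel S)"

definition right_colon ::
    "('a, 'm) semigrp_scheme \<Rightarrow> ('a \<Rightarrow>\<^sub>0 'f::field) set \<Rightarrow> ('a \<Rightarrow>\<^sub>0 'f) set"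
  where "right_colon S J =
    {a \<in> semigrp_algebra S. \<forall>x \<in> semigrp_algebra S. conv S x a \<in> J}"


section \<open>Consistency of the definitions\<close>

lemma factor_semigrp_mult:
  assumes S: "semigrp S" and \<rho>: "semigrp_congruence S \<rho>"
    and a: "a \<in> carrier S" and b: "b \<in> carrier S"
  shows "\<rho> `` {a} \<otimes>\<^bsub>factor_semigrp S \<rho>\<^esub> \<rho> `` {b} = \<rho> `` {a \<otimes>\<^bsub>S\<^esub> b}"
proof -
  have eq: "equiv (carrier S) \<rho>" using \<rho> by (simp add: semigrp_congruence_def)
  have sub: "\<rho> \<subseteq> carrier S \<times> carrier S" and r: "refl_on (carrier S) \<rho>"
    and sy: "sym \<rho>" and tr: "trans \<rho>"
    using eq by (auto simp: equiv_def)
  have cong: "(a \<otimes>\<^bsub>S\<^esub> b, a' \<otimes>\<^bsub>S\<^esub> b') \<in> \<rho>" if "(a, a') \<in> \<rho>" "(b, b') \<in> \<rho>" for a' b'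
  proof -
    have a': "a' \<in> carrier S" using that sub by auto
    have "(a \<otimes>\<^bsub>S\<^esub> b, a' \<otimes>\<^bsub>S\<^esub> b) \<in> \<rho>" "(a' \<otimes>\<^bsub>S\<^esub> b, a' \<otimes>\<^bsub>S\<^esub> b') \<in> \<rho>"
      using that \<rho> a' b unfolding semigrp_congruence_def by blast+
    then show ?thesis using tr by (blast dest: transD)
  qed
  have "(a, a) \<in> \<rho>" "(b, b) \<in> \<rho>" using r a b by (auto dest: refl_onD)
  then show ?thesis
    using cong sy tr unfolding factor_semigrp_def
    by (auto dest: symD transD)
qed

lemma factor_semigrp_semigrp:
  assumes S: "semigrp S" and \<rho>: "semigrp_congruence S \<rho>"
  shows "semigrp (factor_semigrp S \<rho>)"
proof -
  interpret semigrp S by (rule S)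
  have car: "carrier (factor_semigrp S \<rho>) = carrier S // \<rho>" by (simp add: factor_semigrp_def)
  show ?thesis
  proof (unfold_locales, unfold car)
    show "carrier S // \<rho> \<noteq> {}" using nonempty by (auto simp: quotient_def)
  next
    fix X Y assume "X \<in> carrier S // \<rho>" "Y \<in> carrier S // \<rho>"
    then show "X \<otimes>\<^bsub>factor_semigrp S \<rho>\<^esub> Y \<in> carrier S // \<rho>"
      by (auto elim!: quotientE simp: factor_semigrp_mult[OF S \<rho>] intro!: quotientI m_closed)
  next
    fix X Y Z assume "X \<in> carrier S // \<rho>" "Y \<in> carrier S // \<rho>" "Z \<in> carrier S // \<rho>"
    then show "X \<otimes>\<^bsub>factor_semigrp S \<rho>\<^esub> Y \<otimes>\<^bsub>factor_semigrp S \<rho>\<^esub> Z =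
        X \<otimes>\<^bsub>factor_semigrp S \<rho>\<^esub> (Y \<otimes>\<^bsub>factor_semigrp S \<rho>\<^esub> Z)"
      by (auto elim!: quotientE simp: factor_semigrp_mult[OF S \<rho>] m_closed m_assoc)
  qed
qed

lemma rees_congruence_congruence:
  assumes "semigrp S" and "semigrp_ideal S L"
  shows "semigrp_congruence S (rees_congruence S L)"
proof -
  interpret semigrp S by fact
  show ?thesis
    using assms(2) m_closed
    unfolding semigrp_congruence_def semigrp_ideal_def rees_congruence_def equiv_def
    by (auto simp: refl_on_def sym_def trans_def)
qed

lemma conv_single:
  "conv S (Poly_Mapping.single s c) (Poly_Mapping.single t d) =
    Poly_Mapping.single (s \<otimes>\<^bsub>S\<^esub> t) (c * d)"
  by (simp add: conv_def)

lemma conv_closed: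
  assumes "semigrp S" and "a \<in> semigrp_algebra S" and "b \<in> semigrp_algebra S"
  shows "conv S a b \<in> semigrp_algebra S"
proof -
  interpret semigrp S by fact
  have "Poly_Mapping.keys (conv S a b) \<subseteq> carrier S"
    unfolding conv_def
    by (rule order_trans[OF Poly_Mapping.keys_sum] UN_least)+
      (use assms m_closed in \<open>auto simp: semigrp_algebra_def split: if_splits\<close>)
  then show ?thesis by (simp add: semigrp_algebra_def)
qed

lemma lookup_linear_extension:
  "Poly_Mapping.lookup (linear_extension h a) y =
    (\<Sum>s \<in> {s \<in> Poly_Mapping.keys a. h s = y}. Poly_Mapping.lookup a s)"
  by (simp add: linear_extension_def lookup_sum lookup_single when_def sum.inter_filter)

lemma congruence_ideal_iff:
  assumes "semigrp_congruence S \<rho>" and a: "a \<in> semigrp_algebra S"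
  shows "a \<in> congruence_ideal S \<rho> \<longleftrightarrow>
    (\<forall>A \<in> carrier S // \<rho>. (\<Sum>s \<in> A \<inter> Poly_Mapping.keys a. Poly_Mapping.lookup a s) = 0)"
proof -
  have eq: "equiv (carrier S) \<rho>" using assms(1) by (simp add: semigrp_congruence_def)
  have keys: "Poly_Mapping.keys a \<subseteq> carrier S" using a by (simp add: semigrp_algebra_def)
  have fib: "{s \<in> Poly_Mapping.keys a. \<rho> `` {s} = A} = A \<inter> Poly_Mapping.keys a"
    if "A \<in> carrier S // \<rho>" for A
  proof -
    from that obtain x where x: "x \<in> carrier S" "A = \<rho> `` {x}" by (auto elim: quotientE)
    have "\<rho> `` {s} = A \<longleftrightarrow> s \<in> A" if "s \<in> carrier S" for s
      using eq_equiv_class_iff[OF eq x(1) that] x by auto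
    then show ?thesis using keys by auto
  qed
  have nil: "{s \<in> Poly_Mapping.keys a. \<rho> `` {s} = A} = {}" if "A \<notin> carrier S // \<rho>" for A
    using that keys by (auto intro: quotientI)
  have "a \<in> congruence_ideal S \<rho> \<longleftrightarrow>
    (\<forall>A. (\<Sum>s \<in> {s \<in> Poly_Mapping.keys a. \<rho> `` {s} = A}. Poly_Mapping.lookup a s) = 0)"
    using a by (simp add: congruence_ideal_def poly_mapping_eq_iff fun_eq_iff
        lookup_linear_extension)
  also have "\<dots> \<longleftrightarrow>
    (\<forall>A \<in> carrier S // \<rho>. (\<Sum>s \<in> A \<inter> Poly_Mapping.keys a. Poly_Mapping.lookup a s) = 0)"
  proof (intro iffI allI ballI)
    fix A assume *: "\<forall>A. (\<Sum>s \<in> {s \<in> Poly_Mapping.keys a. \<rho> `` {s} = A}. Poly_Mapping.lookup a s) = 0"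
      and A: "A \<in> carrier S // \<rho>"
    show "(\<Sum>s \<in> A \<inter> Poly_Mapping.keys a. Poly_Mapping.lookup a s) = 0"
      unfolding fib[OF A, symmetric] by (rule *[rule_format])
  next
    fix A
    assume *: "\<forall>A \<in> carrier S // \<rho>. (\<Sum>s \<in> A \<inter> Poly_Mapping.keys a. Poly_Mapping.lookup a s) = 0"
    show "(\<Sum>s \<in> {s \<in> Poly_Mapping.keys a. \<rho> `` {s} = A}. Poly_Mapping.lookup a s) = 0"
    proof (cases "A \<in> carrier S // \<rho>")
      case True
      show ?thesis unfolding fib[OF True] by (rule *[rule_format, OF True])
    next
      case False
      show ?thesis unfolding nil[OF False] by (rule sum.empty)
    qed
  qed
  finally show ?thesis .
qed

lemma augmentation_ideal_iff:
  "a \<in> augmentation_ideal S \<longleftrightarrow> a \<in> semigrp_algebra S \<and>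
    (\<Sum>s \<in> Poly_Mapping.keys a. Poly_Mapping.lookup a s) = 0"
proof (cases "a \<in> semigrp_algebra S")
  case True
  then have "universal_rel S `` {s} = carrier S" if "s \<in> Poly_Mapping.keys a" for s
    using that by (auto simp: universal_rel_def semigrp_algebra_def)
  then have "{s \<in> Poly_Mapping.keys a. universal_rel S `` {s} = A} =
      (if A = carrier S then Poly_Mapping.keys a else {})" for A
    by auto
  then show ?thesis using True
    by (auto simp: augmentation_ideal_def congruence_ideal_def poly_mapping_eq_iff fun_eq_iff
        lookup_linear_extension)
qed (simp add: augmentation_ideal_def congruence_ideal_def)

end

(* Both conditions say that left multiplication in S/\<rho> is constant: xa = xb for all x, a, b.
   On the algebra side, test this on the differences a - b, which lie in the augmentation ideal;
   conversely, if xa modulo \<rho> depends only on x, then x times an element of F[S] depends modulo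
   F[\<rho>] only on the sum of the coefficients. On the semigroup side, if xa = xb throughout
   T = S/\<rho>, then T\<^sup>2 is the ideal sought. In the other direction, l a = l for every l in the left
   zero ideal and every a, so all a, b are equalized by l, and left equalizer simplicity
   transports xa = xb to every x. *)

theory Submission
  imports Defs
begin

section \<open>Linear extensions\<close>

text \<open>Coefficients vanish off the support, so enlarging the index set adds only zero summands.
  Two elements with different supports can thus be summed over one common set, which additivity
  requires.\<close>

lemma linear_extension_superset:
  assumes "finite A" and "Poly_Mapping.keys a \<subseteq> A"
  shows "linear_extension h a =
    (\<Sum>s\<in>A. Poly_Mapping.single (h s) (Poly_Mapping.lookup a s))"
  unfolding linear_extension_def
  by (rule sum.mono_neutral_left) (use assms in \<open>auto simp: in_keys_iff\<close>)

lemma linear_extension_zero: "linear_extension h 0 = 0"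
  by (simp add: linear_extension_def)

lemma linear_extension_single:
  "linear_extension h (Poly_Mapping.single s c) = Poly_Mapping.single (h s) c"
  by (simp add: linear_extension_def)

lemma linear_extension_add:
  "linear_extension h (a + b) = linear_extension h a + linear_extension h b"
proof -
  let ?A = "Poly_Mapping.keys a \<union> Poly_Mapping.keys b"
  have fin: "finite ?A" by simp
  show ?thesis
    unfolding linear_extension_superset[OF fin Poly_Mapping.keys_add, of h]
      linear_extension_superset[OF fin Un_upper1, of h]
      linear_extension_superset[OF fin Un_upper2, of h]
    by (simp add: lookup_add single_add sum.distrib)
qed

lemma linear_extension_sum:
  "linear_extension h (\<Sum>i\<in>I. f i) = (\<Sum>i\<in>I. linear_extension h (f i))"
  by (induction I rule: infinite_finite_induct)
    (simp_all add: linear_extension_zero linear_extension_add)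

lemma linear_extension_linear_extension:
  "linear_extension g (linear_extension h a) = linear_extension (\<lambda>s. g (h s)) a"
  unfolding linear_extension_def[of h]
  by (simp add: linear_extension_sum linear_extension_single)
    (simp add: linear_extension_def)

text \<open>Keeping the double sum indexed by the two factors allows the images of products to be
  rewritten before any coefficients are collected.\<close>

lemma linear_extension_conv:
  "linear_extension h (conv S x a) =
    (\<Sum>s\<in>Poly_Mapping.keys x. \<Sum>t\<in>Poly_Mapping.keys a.
      Poly_Mapping.single (h (s \<otimes>\<^bsub>S\<^esub> t)) (Poly_Mapping.lookup x s * Poly_Mapping.lookup a t))"
  by (simp add: conv_def linear_extension_sum linear_extension_single)

lemma single_sum:
  "Poly_Mapping.single k (\<Sum>i\<in>I. f i) = (\<Sum>i\<in>I. Poly_Mapping.single k (f i))"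
  by (induction I rule: infinite_finite_induct) (simp_all add: single_add)

lemma single_eq_zero_iff: "Poly_Mapping.single k c = 0 \<longleftrightarrow> c = 0"
  by (metis lookup_single_eq lookup_zero single_zero)

text \<open>Collapsing the whole basis to one point turns the linear extension into the augmentation
  map; \<open>k = ()\<close> is used for this below.\<close>

lemma linear_extension_const:
  "linear_extension (\<lambda>_. k) a =
    Poly_Mapping.single k (\<Sum>s\<in>Poly_Mapping.keys a. Poly_Mapping.lookup a s)"
  by (simp add: linear_extension_def single_sum)

section \<open>The right colon of a congruence ideal\<close>

text \<open>The map to a point factors through the map to classes, so the augmentation map kills
  whatever the extension to classes kills.\<close>

lemma congruence_ideal_subset_augmentation_ideal:
  "congruence_ideal S \<rho> \<subseteq> augmentation_ideal S"
proof
  fix a :: "'a \<Rightarrow>\<^sub>0 'f::field"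
  assume a: "a \<in> congruence_ideal S \<rho>"
  then have "linear_extension (\<lambda>_. ()) (linear_extension (\<lambda>s. \<rho> `` {s}) a) = 0"
    by (simp add: congruence_ideal_def linear_extension_zero)
  then have "(\<Sum>s\<in>Poly_Mapping.keys a. Poly_Mapping.lookup a s) = 0"
    unfolding linear_extension_linear_extension
    by (simp add: linear_extension_const single_eq_zero_iff)
  then show "a \<in> augmentation_ideal S"
    using a by (simp add: augmentation_ideal_iff congruence_ideal_def)
qed

text \<open>Left multiplication by a basis element \<open>x\<close> preserves the sum of
  coefficients. That sum is 0 for the product, which lies in the congruence ideal, hence it is 0 for
  \<open>a\<close>.\<close>

lemma right_colon_subset_augmentation_ideal:
  assumes "semigrp S"
  shows "right_colon S (congruence_ideal S \<rho>) \<subseteq> (augmentation_ideal S :: ('a \<Rightarrow>\<^sub>0 'f::field) set)"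
proof
  interpret semigrp S by fact
  fix a :: "'a \<Rightarrow>\<^sub>0 'f"
  assume a: "a \<in> right_colon S (congruence_ideal S \<rho>)"
  obtain x where x: "x \<in> carrier S" using nonempty by blast
  let ?x = "Poly_Mapping.single x 1 :: 'a \<Rightarrow>\<^sub>0 'f"
  have "?x \<in> semigrp_algebra S" using x by (simp add: semigrp_algebra_def)
  then have "conv S ?x a \<in> congruence_ideal S \<rho>"
    using a by (simp add: right_colon_def)
  then have "conv S ?x a \<in> augmentation_ideal S"
    using congruence_ideal_subset_augmentation_ideal by blast
  then have "linear_extension (\<lambda>_. ()) (conv S ?x a) = 0"
    by (simp add: linear_extension_const augmentation_ideal_iff)
  then have "(\<Sum>s\<in>Poly_Mapping.keys a. Poly_Mapping.lookup a s) = 0"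
    by (simp add: linear_extension_conv single_eq_zero_iff flip: single_sum)
  then show "a \<in> augmentation_ideal S"
    using a by (simp add: augmentation_ideal_iff right_colon_def)
qed

lemma right_colon_eq_augmentation_ideal_iff:
  assumes S: "semigrp S" and \<rho>: "semigrp_congruence S \<rho>"
  shows "right_colon S (congruence_ideal S \<rho>) = (augmentation_ideal S :: ('a \<Rightarrow>\<^sub>0 'f::field) set)
    \<longleftrightarrow> (\<forall>x\<in>carrier S. \<forall>a\<in>carrier S. \<forall>b\<in>carrier S. (x \<otimes>\<^bsub>S\<^esub> a, x \<otimes>\<^bsub>S\<^esub> b) \<in> \<rho>)"
    (is "?colon = ?aug \<longleftrightarrow> ?const")
proof -
  interpret semigrp S by (rule S)
  have eq: "equiv (carrier S) \<rho>" using \<rho> by (simp add: semigrp_congruence_def)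
  have "?const" if colon: "?colon = ?aug"
  proof (intro ballI)
    fix x a b assume x: "x \<in> carrier S" and a: "a \<in> carrier S" and b: "b \<in> carrier S"
    show "(x \<otimes>\<^bsub>S\<^esub> a, x \<otimes>\<^bsub>S\<^esub> b) \<in> \<rho>"
    \<comment> \<open>For equal elements the difference would be 0 with empty support, so this case
      is settled by reflexivity.\<close>
    proof (cases "a = b")
      case True
      then show ?thesis using eq x a m_closed by (auto simp: equiv_def dest: refl_onD)
    next
      case False
      let ?x = "Poly_Mapping.single x 1 :: 'a \<Rightarrow>\<^sub>0 'f"
      let ?d = "Poly_Mapping.single a 1 + Poly_Mapping.single b (- 1) :: 'a \<Rightarrow>\<^sub>0 'f"
      have keys: "Poly_Mapping.keys ?d = {a, b}"
        using False by (auto simp: in_keys_iff lookup_add lookup_single when_def split: if_splits)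
      have lookup: "Poly_Mapping.lookup ?d a = 1" "Poly_Mapping.lookup ?d b = - 1"
        using False by (simp_all add: lookup_add lookup_single)
      have "?d \<in> ?aug"
        using a b False by (simp add: augmentation_ideal_iff semigrp_algebra_def keys lookup)
      moreover have "?x \<in> semigrp_algebra S" using x by (simp add: semigrp_algebra_def)
      ultimately have "conv S ?x ?d \<in> congruence_ideal S \<rho>"
        using colon by (auto simp: right_colon_def)
      then have "linear_extension (\<lambda>s. \<rho> `` {s}) (conv S ?x ?d) = 0"
        by (simp add: congruence_ideal_def)
      then have "Poly_Mapping.single (\<rho> `` {x \<otimes>\<^bsub>S\<^esub> a}) (1::'f)
          + Poly_Mapping.single (\<rho> `` {x \<otimes>\<^bsub>S\<^esub> b}) (- 1) = 0"
        using False by (simp add: linear_extension_conv keys lookup)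
      \<comment> \<open>The coefficient at the class of \<open>xa\<close> would be 1 if the class of
        \<open>xb\<close> were different, in any characteristic.\<close>
      then have "Poly_Mapping.lookup (Poly_Mapping.single (\<rho> `` {x \<otimes>\<^bsub>S\<^esub> a}) (1::'f)
          + Poly_Mapping.single (\<rho> `` {x \<otimes>\<^bsub>S\<^esub> b}) (- 1)) (\<rho> `` {x \<otimes>\<^bsub>S\<^esub> a}) = 0"
        by simp
      then have "\<rho> `` {x \<otimes>\<^bsub>S\<^esub> a} = \<rho> `` {x \<otimes>\<^bsub>S\<^esub> b}"
        by (auto simp: lookup_add lookup_single when_def split: if_splits)
      then show ?thesis using eq_equiv_class_iff[OF eq] x a b m_closed by blast
    qed
  qed
  moreover have "?aug \<subseteq> ?colon" if const: ?const
  proof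
    fix a :: "'a \<Rightarrow>\<^sub>0 'f"
    assume "a \<in> ?aug"
    then have a: "a \<in> semigrp_algebra S"
      and sum: "(\<Sum>t\<in>Poly_Mapping.keys a. Poly_Mapping.lookup a t) = 0"
      by (simp_all add: augmentation_ideal_iff)
    have "conv S x a \<in> congruence_ideal S \<rho>" if x: "x \<in> semigrp_algebra S" for x
    proof -
      \<comment> \<open>An arbitrary fixed right factor: by \<open>?const\<close> it can replace
        every \<open>t\<close>, so the basis element no longer depends on \<open>t\<close>, and the
        inner sum becomes a multiple of the coefficient sum of \<open>a\<close>.\<close>
      obtain c where c: "c \<in> carrier S" using nonempty by blast
      have "\<rho> `` {s \<otimes>\<^bsub>S\<^esub> t} = \<rho> `` {s \<otimes>\<^bsub>S\<^esub> c}"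
        if "s \<in> Poly_Mapping.keys x" "t \<in> Poly_Mapping.keys a" for s t
        using that x a c const unfolding semigrp_algebra_def by (intro equiv_class_eq[OF eq]) blast
      then have "linear_extension (\<lambda>s. \<rho> `` {s}) (conv S x a) =
          (\<Sum>s\<in>Poly_Mapping.keys x. \<Sum>t\<in>Poly_Mapping.keys a. Poly_Mapping.single
            (\<rho> `` {s \<otimes>\<^bsub>S\<^esub> c}) (Poly_Mapping.lookup x s * Poly_Mapping.lookup a t))"
        by (simp add: linear_extension_conv)
      also have "\<dots> = 0"
        by (simp add: sum flip: single_sum sum_distrib_left)
      finally show ?thesis
        using conv_closed[OF S x a] by (simp add: congruence_ideal_def)
    qed
    then show "a \<in> ?colon" using a by (simp add: right_colon_def)
  qed
  ultimately show ?thesis using right_colon_subset_augmentation_ideal[OF S] by blast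
qed

section \<open>Ideal extensions of left zero semigroups by null semigroups\<close>

lemma null_rees_factorI:
  assumes T: "semigrp T" and L: "semigrp_ideal T L"
    and prod: "\<And>a b. \<lbrakk>a \<in> carrier T; b \<in> carrier T\<rbrakk> \<Longrightarrow> a \<otimes>\<^bsub>T\<^esub> b \<in> L"
  shows "null_semigrp (rees_factor T L)"
proof -
  define \<sigma> where "\<sigma> = rees_congruence T L"
  have \<sigma>: "semigrp_congruence T \<sigma>"
    unfolding \<sigma>_def by (rule rees_congruence_congruence[OF T L])
  have R: "rees_factor T L = factor_semigrp T \<sigma>"
    by (simp add: rees_factor_def \<sigma>_def)
  have car: "carrier (factor_semigrp T \<sigma>) = carrier T // \<sigma>"
    by (simp add: factor_semigrp_def)
  have L_sub: "L \<subseteq> carrier T" using L by (simp add: semigrp_ideal_def)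
  \<comment> \<open>As a single Rees class, \<open>L\<close> is itself an element of the factor. It
    is the zero there, since every product of representatives falls into it.\<close>
  have classL: "\<sigma> `` {a} = L" if "a \<in> L" for a
    using that L_sub by (auto simp: \<sigma>_def rees_congruence_def)
  obtain e where e: "e \<in> L" using L by (auto simp: semigrp_ideal_def)
  then have "\<sigma> `` {e} \<in> carrier T // \<sigma>" using L_sub by (blast intro: quotientI)
  then have Lcar: "L \<in> carrier (factor_semigrp T \<sigma>)" by (simp add: car classL[OF e])
  have all: "A \<otimes>\<^bsub>factor_semigrp T \<sigma>\<^esub> B = L"
    if "A \<in> carrier (factor_semigrp T \<sigma>)" "B \<in> carrier (factor_semigrp T \<sigma>)" for A B
    using that prod unfolding car
    by (auto elim!: quotientE simp: factor_semigrp_mult[OF T \<sigma>] classL)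
  have "{A \<otimes>\<^bsub>factor_semigrp T \<sigma>\<^esub> B | A B. A \<in> carrier (factor_semigrp T \<sigma>) \<and>
      B \<in> carrier (factor_semigrp T \<sigma>)} = {L}"
    using all Lcar by blast
  then show ?thesis
    using Lcar all factor_semigrp_semigrp[OF T \<sigma>] unfolding R null_semigrp_def by blast
qed

text \<open>Both \<open>la\<close> and \<open>al\<close> lie in \<open>L\<close>, so the left zero
  identity applies on either side of associativity: \<open>la = (la)l = l(al) = l\<close>.\<close>

lemma left_zero_ideal_absorbs:
  assumes T: "semigrp T" and L: "semigrp_ideal T L" and lz: "left_zero_semigrp (T\<lparr>carrier := L\<rparr>)"
    and l: "l \<in> L" and a: "a \<in> carrier T"
  shows "l \<otimes>\<^bsub>T\<^esub> a = l"
proof -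
  interpret semigrp T by (rule T)
  have zero: "x \<otimes>\<^bsub>T\<^esub> y = x" if "x \<in> L" "y \<in> L" for x y
    using that lz by (simp add: left_zero_semigrp_def)
  have lT: "l \<in> carrier T" and la: "l \<otimes>\<^bsub>T\<^esub> a \<in> L" and al: "a \<otimes>\<^bsub>T\<^esub> l \<in> L"
    using L l a by (auto simp: semigrp_ideal_def)
  have "l \<otimes>\<^bsub>T\<^esub> a = (l \<otimes>\<^bsub>T\<^esub> a) \<otimes>\<^bsub>T\<^esub> l" using zero[OF la l] by simp
  also have "\<dots> = l \<otimes>\<^bsub>T\<^esub> (a \<otimes>\<^bsub>T\<^esub> l)" by (rule m_assoc[OF lT a lT])
  also have "\<dots> = l" by (rule zero[OF l al])
  finally show ?thesis .
qed

lemma constant_mult_imp_left_zero_by_null: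
  assumes T: "semigrp T"
    and const: "\<And>x a b. \<lbrakk>x \<in> carrier T; a \<in> carrier T; b \<in> carrier T\<rbrakk> \<Longrightarrow> x \<otimes>\<^bsub>T\<^esub> a = x \<otimes>\<^bsub>T\<^esub> b"
  shows "\<exists>L. semigrp_ideal T L \<and> left_zero_semigrp (T\<lparr>carrier := L\<rparr>) \<and>
    null_semigrp (rees_factor T L)"
proof -
  interpret semigrp T by (rule T)
  define L where "L = {x \<otimes>\<^bsub>T\<^esub> a | x a. x \<in> carrier T \<and> a \<in> carrier T}"
  have prod: "x \<otimes>\<^bsub>T\<^esub> a \<in> L" if "x \<in> carrier T" "a \<in> carrier T" for x a
    using that by (auto simp: L_def)
  have sub: "L \<subseteq> carrier T" using m_closed by (auto simp: L_def)
  have ne: "L \<noteq> {}" using nonempty prod by blast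
  have ideal: "semigrp_ideal T L"
    unfolding semigrp_ideal_def using ne sub prod by blast
  have zero: "l \<otimes>\<^bsub>T\<^esub> a = l" if l: "l \<in> L" and a: "a \<in> carrier T" for l a
  proof -
    from l obtain x b where x: "x \<in> carrier T" and b: "b \<in> carrier T" and "l = x \<otimes>\<^bsub>T\<^esub> b"
      by (auto simp: L_def)
    \<comment> \<open>For \<open>l = xb\<close> the product is \<open>(xb)a = x(ba)\<close>, and
      constancy lets \<open>b\<close> replace \<open>ba\<close>.\<close>
    then show ?thesis using m_assoc[OF x b a] const[OF x m_closed[OF b a] b] by simp
  qed
  have "semigrp (T\<lparr>carrier := L\<rparr>)"
    by unfold_locales (use ne sub prod m_assoc in \<open>auto simp: subset_iff\<close>)
  then have "left_zero_semigrp (T\<lparr>carrier := L\<rparr>)"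
    using zero sub by (auto simp: left_zero_semigrp_def)
  moreover have "null_semigrp (rees_factor T L)"
    by (rule null_rees_factorI[OF T ideal prod])
  ultimately show ?thesis using ideal by blast
qed

theorem theorem4p1:
  fixes S :: "('a, 'm) semigrp_scheme" and \<rho> :: "('a \<times> 'a) set"
  assumes "semigrp S"
    and "left_equalizer_simple S \<rho>"
  shows "right_colon S (congruence_ideal S \<rho>) = (augmentation_ideal S :: ('a \<Rightarrow>\<^sub>0 'f::field) set)
    \<longleftrightarrow> (\<exists>L. semigrp_ideal (factor_semigrp S \<rho>) L \<and>
          left_zero_semigrp ((factor_semigrp S \<rho>)\<lparr>carrier := L\<rparr>) \<and>
          null_semigrp (rees_factor (factor_semigrp S \<rho>) L))"
proof -
  note S = \<open>semigrp S\<close>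
  interpret semigrp S by (rule S)
  have \<rho>: "semigrp_congruence S \<rho>" using assms(2) by (simp add: left_equalizer_simple_def)
  have eq: "equiv (carrier S) \<rho>" using \<rho> by (simp add: semigrp_congruence_def)
  let ?T = "factor_semigrp S \<rho>"
  have T: "semigrp ?T" by (rule factor_semigrp_semigrp[OF S \<rho>])
  have car: "carrier ?T = carrier S // \<rho>" by (simp add: factor_semigrp_def)
  \<comment> \<open>The intermediate condition is stated on representatives in \<open>S\<close>,
    where both the colon criterion and left equalizer simplicity are formulated.\<close>
  have "(\<forall>x\<in>carrier S. \<forall>a\<in>carrier S. \<forall>b\<in>carrier S. (x \<otimes>\<^bsub>S\<^esub> a, x \<otimes>\<^bsub>S\<^esub> b) \<in> \<rho>) \<longleftrightarrow>
    (\<exists>L. semigrp_ideal ?T L \<and> left_zero_semigrp (?T\<lparr>carrier := L\<rparr>) \<and>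
      null_semigrp (rees_factor ?T L))" (is "?const \<longleftrightarrow> ?ext")
  proof
    assume const: ?const
    show ?ext
    proof (rule constant_mult_imp_left_zero_by_null[OF T])
      fix X A B assume "X \<in> carrier ?T" "A \<in> carrier ?T" "B \<in> carrier ?T"
      then obtain x a b where x: "x \<in> carrier S" and a: "a \<in> carrier S" and b: "b \<in> carrier S"
        and "X = \<rho> `` {x}" "A = \<rho> `` {a}" "B = \<rho> `` {b}"
        unfolding car by (meson quotientE)
      moreover have "\<rho> `` {x \<otimes>\<^bsub>S\<^esub> a} = \<rho> `` {x \<otimes>\<^bsub>S\<^esub> b}"
        using const x a b by (intro equiv_class_eq[OF eq]) blast
      ultimately show "X \<otimes>\<^bsub>?T\<^esub> A = X \<otimes>\<^bsub>?T\<^esub> B"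
        by (simp add: factor_semigrp_mult[OF S \<rho>])
    qed
  next
    assume ?ext
    then obtain L where L: "semigrp_ideal ?T L" and lz: "left_zero_semigrp (?T\<lparr>carrier := L\<rparr>)"
      by blast
    from L obtain A where "A \<in> L" "A \<in> carrier S // \<rho>"
      by (auto simp: semigrp_ideal_def car)
    then obtain l where l: "l \<in> carrier S" "\<rho> `` {l} \<in> L"
      by (auto elim: quotientE)
    have absorb: "\<rho> `` {l \<otimes>\<^bsub>S\<^esub> a} = \<rho> `` {l}" if a: "a \<in> carrier S" for a
    proof -
      have "\<rho> `` {a} \<in> carrier ?T" unfolding car using a by (rule quotientI)
      from left_zero_ideal_absorbs[OF T L lz l(2) this]
      show ?thesis using a l(1) by (simp add: factor_semigrp_mult[OF S \<rho>])
    qed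
    have "(l \<otimes>\<^bsub>S\<^esub> a, l \<otimes>\<^bsub>S\<^esub> b) \<in> \<rho>" if "a \<in> carrier S" "b \<in> carrier S" for a b
    proof -
      have "\<rho> `` {l \<otimes>\<^bsub>S\<^esub> a} = \<rho> `` {l \<otimes>\<^bsub>S\<^esub> b}" using absorb that by simp
      then show ?thesis using l(1) that m_closed by (blast intro: eq_equiv_class[OF _ eq])
    qed
    then show ?const
      using assms(2) l(1) unfolding left_equalizer_simple_def by blast
  qed
  then show ?thesis by (simp only: right_colon_eq_augmentation_ideal_iff[OF S \<rho>])
qed

end
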